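(* Let $(\Phi^{(j)})_{j=1}^\infty$ be a non-autonomous IFS on a compact metric space $X$ with limit set $J$, let $c<1$ be the uniform upper bound of the Lipschitz constants of its maps, and let $\mathcal N_{0,k}$ ($k\ge1$) be its associated nerves. If $$\lim_{k\to\infty}c^k\max\{\#V(\mathcal K) : \mathcal K\text{ is a component of }\mathcal N_{0,k}\}=0,$$ then $J$ is totally disconnected. Here $V(\mathcal K)$ denotes the vertex set of the simplicial complex $\mathcal K$, and $\#A$ denotes the number of elements of a set $A$.
   Context: Let $X$ be a non-empty compact metric space; $\mathrm{Lip}(f)$ denotes the Lipschitz constant of $f\colon X\to X$. A non-autonomous IFS $(\Phi^{(j)})_{j\ge1}$ on $X$ is a sequence of collections $\Phi^{(j)}=\{f^{(j)}_i\colon X\to X\}_{i\in I^{(j)}}$ of maps, with each index set $I^{(j)}$ finite and non-empty, such that there is a constant $c<1$ with $\mathrm{Lip}(f^{(j)}_i)\le c$ for all $j\ge1$, $i\in I^{(j)}$. Its coding map $\Pi\colon\prod_{j\ge1}I^{(j)}\to X$ is defined by $\{\Pi(i_1,i_2,\dots)\}=\bigcap_{j\ge1}f^{(1)}_{i_1}\circ\cdots\circ f^{(j)}_{i_j}(X)$, and its limit set is $J=\Pi(\prod_{j\ge1}I^{(j)})$. For $j\ge0$, $J_j$ denotes the limit set of the shifted system $(\Phi^{(j+k)})_{k\ge1}$, so $J_0=J$. For $0\le j<k$ and $v=(i_{j+1},\dots,i_k)\in I^{(j+1)}\times\cdots\times I^{(k)}$ put $f_v=f^{(j+1)}_{i_{j+1}}\circ\cdots\circ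 f^{(k)}_{i_k}$. The nerve $\mathcal N_{j,k}$ is the abstract simplicial complex with vertex set $I^{(j+1)}\times\cdots\times I^{(k)}$, in which a set $\{v_0,\dots,v_q\}$ of mutually distinct vertices is a simplex iff $\bigcap_{p=0}^q f_{v_p}(J_k)\ne\emptyset$. For a simplicial complex $\mathcal K$, let $\sim$ be the equivalence relation on $V(\mathcal K)$ generated by $u\sim v$ whenever $\{u,v\}$ is a 1-simplex. A component of $\mathcal K$ is a subcomplex $\{s\in\mathcal K : s\subset[v]\}$, where $[v]$ is the equivalence class of some $v\in V(\mathcal K)$. *)

theory Defs
  imports "HOL-Analysis.Analysis"
begin

text \<open>
  A sequence indexed by \<open>j \<ge> 1\<close> is a function on \<open>nat\<close> whose value at \<open>0\<close> is never used.
  A finite word in \<open>I (j+1) \<times> \<dots> \<times> I k\<close> is an element of \<open>PiE {j+1..k} I\<close>, an infinite one an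
  element of \<open>PiE {1..} I\<close>.  The compact metric space is a compact subset \<open>X\<close> of a metric type;
  the maps are only constrained on \<open>X\<close>.
\<close>

text \<open>
  The last argument \<open>c\<close> is a uniform bound for the Lipschitz constants; the inequality
  \<open>Lip (f j i) \<le> c\<close> is \<open>c-lipschitz_on X (f j i)\<close> (which includes \<open>0 \<le> c\<close>).
\<close>

definition nonautonomous_ifs ::
    "'a::metric_space set \<Rightarrow> (nat \<Rightarrow> 'i set) \<Rightarrow> (nat \<Rightarrow> 'i \<Rightarrow> 'a \<Rightarrow> 'a) \<Rightarrow> real \<Rightarrow> bool" where
  "nonautonomous_ifs X I f c \<longleftrightarrow>
     compact X \<and> X \<noteq> {} \<and> c < 1 \<and>
     (\<forall>j\<ge>1. finite (I j) \<and> I j \<noteq> {}) \<and>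
     (\<forall>j\<ge>1. \<forall>i\<in>I j. f j i ` X \<subseteq> X \<and> c-lipschitz_on X (f j i))"

text \<open>\<open>word_map f j k v = f (j+1) (v (j+1)) \<circ> \<dots> \<circ> f k (v k)\<close>\<close>

definition word_map ::
    "(nat \<Rightarrow> 'i \<Rightarrow> 'a \<Rightarrow> 'a) \<Rightarrow> nat \<Rightarrow> nat \<Rightarrow> (nat \<Rightarrow> 'i) \<Rightarrow> 'a \<Rightarrow> 'a" where
  "word_map f j k v = foldr (\<circ>) (map (\<lambda>l. f l (v l)) [j+1..<k+1]) id"

text \<open>
  For a non-autonomous IFS the intersection below is a singleton, since \<open>X\<close> is compact and the
  diameters of the nested images tend to \<open>0\<close>.
\<close>

definition coding_map ::
    "'a set \<Rightarrow> (nat \<Rightarrow> 'i \<Rightarrow> 'a \<Rightarrow> 'a) \<Rightarrow> (nat \<Rightarrow> 'i) \<Rightarrow> 'a" where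
  "coding_map X f \<omega> = the_elem (\<Inter>j\<in>{1..}. word_map f 0 j \<omega> ` X)"

definition limit_set ::
    "'a set \<Rightarrow> (nat \<Rightarrow> 'i set) \<Rightarrow> (nat \<Rightarrow> 'i \<Rightarrow> 'a \<Rightarrow> 'a) \<Rightarrow> 'a set" where
  "limit_set X I f = coding_map X f ` (PiE {1..} I)"

definition shifted_limit_set ::
    "'a set \<Rightarrow> (nat \<Rightarrow> 'i set) \<Rightarrow> (nat \<Rightarrow> 'i \<Rightarrow> 'a \<Rightarrow> 'a) \<Rightarrow> nat \<Rightarrow> 'a set" where
  "shifted_limit_set X I f j = limit_set X (\<lambda>k. I (j + k)) (\<lambda>k. f (j + k))"

text \<open>
  An abstract simplicial complex is represented by its set of simplices (finite non-empty sets
  of vertices, every vertex \<open>v\<close> giving the simplex \<open>{v}\<close>), so that its vertex set is their union.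
\<close>

definition vertices :: "'v set set \<Rightarrow> 'v set" where
  "vertices K = \<Union>K"

definition vertex_equiv :: "'v set set \<Rightarrow> 'v \<Rightarrow> 'v \<Rightarrow> bool" where
  "vertex_equiv K = equivclp (\<lambda>u v. u \<noteq> v \<and> {u, v} \<in> K)"

definition complex_components :: "'v set set \<Rightarrow> 'v set set set" where
  "complex_components K = {{s \<in> K. s \<subseteq> {u. vertex_equiv K v u}} | v. v \<in> vertices K}"

text \<open>
  Every word is a vertex of the nerve, because the limit sets of a non-autonomous IFS are
  non-empty.
\<close>

definition nerve ::
    "'a set \<Rightarrow> (nat \<Rightarrow> 'i set) \<Rightarrow> (nat \<Rightarrow> 'i \<Rightarrow> 'a \<Rightarrow> 'a) \<Rightarrow> nat \<Rightarrow> nat \<Rightarrow> (nat \<Rightarrow> 'i) set set" where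
  "nerve X I f j k =
     {s. finite s \<and> s \<noteq> {} \<and> s \<subseteq> PiE {j+1..k} I \<and>
         (\<Inter>v\<in>s. word_map f j k v ` shifted_limit_set X I f k) \<noteq> {}}"

definition totally_disconnected :: "'a::topological_space set \<Rightarrow> bool" where
  "totally_disconnected S \<longleftrightarrow> (\<forall>C\<in>components S. \<exists>x. C = {x})"

end

theory Submission
  imports Defs
begin

text \<open>
  Fix a level \<open>k\<close>.  The limit set is the union of the finitely many pieces \<open>f\<^sub>v(J\<^sub>k)\<close>, one for each
  word \<open>v\<close> of length \<open>k\<close> (\<open>limit_set_decomposition\<close>), and two pieces meet exactly when their words
  span a simplex of the nerve.  Grouping the pieces by the components of the nerve therefore
  partitions \<open>J\<close> into finitely many sets, each of which is closed because the limit sets are compact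
  (\<open>compact_limit_set\<close>).  Hence a connected subset of \<open>J\<close> lies in a single group
  (\<open>connected_subset_one_class\<close>).  A piece has diameter at most \<open>c\<^sup>k diam X\<close>, and any two pieces
  of a group are joined by a chain of consecutively intersecting, pairwise distinct pieces, so a
  group with \<open>N\<close> words has diameter at most \<open>N c\<^sup>k diam X\<close> (\<open>dist_le_card_mult_chain\<close>).  By
  hypothesis this bound tends to \<open>0\<close>, so a connected subset of \<open>J\<close> has at most one point.

  Compactness of the limit sets is obtained from \<open>J\<^sub>m = (\<Union>i. f\<^sub>i(J\<^sub>m\<^sub>+\<^sub>1))\<close>: the closures of the
  \<open>J\<^sub>m\<close> satisfy the inclusion \<open>\<subseteq>\<close> of this identity as well, and following it from a point in the
  closure of \<open>J\<close> produces an infinite word coding that point.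
\<close>

section \<open>Chains of intersecting sets\<close>

text \<open>
  A path ending at \<open>w \<noteq> u\<close> can be cut after its last visit to \<open>u\<close>; the remaining part avoids \<open>u\<close>.
\<close>

lemma rtranclp_avoiding:
  assumes "R\<^sup>*\<^sup>* a w" "u \<noteq> w"
  shows "(a \<noteq> u \<and> (\<lambda>x y. R x y \<and> x \<noteq> u \<and> y \<noteq> u)\<^sup>*\<^sup>* a w) \<or>
         (\<exists>b. R u b \<and> b \<noteq> u \<and> (\<lambda>x y. R x y \<and> x \<noteq> u \<and> y \<noteq> u)\<^sup>*\<^sup>* b w)"
  using assms(1)
proof (induction rule: converse_rtranclp_induct)
  case base
  then show ?case using assms(2) by auto
next
  case (step a b)
  show ?case
  proof (cases "\<exists>b. R u b \<and> b \<noteq> u \<and> (\<lambda>x y. R x y \<and> x \<noteq> u \<and> y \<noteq> u)\<^sup>*\<^sup>* b w")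
    case False
    with step.IH have b: "b \<noteq> u" "(\<lambda>x y. R x y \<and> x \<noteq> u \<and> y \<noteq> u)\<^sup>*\<^sup>* b w" by auto
    with False step.hyps have "a \<noteq> u" by auto
    with b step.hyps have "(\<lambda>x y. R x y \<and> x \<noteq> u \<and> y \<noteq> u)\<^sup>*\<^sup>* a w"
      by (intro converse_rtranclp_into_rtranclp[of _ a b]) auto
    with \<open>a \<noteq> u\<close> show ?thesis by simp
  qed simp
qed

text \<open>
  The number of links is bounded by the number of vertices, not of edges: after leaving \<open>u\<close> for the
  last time, the chain stays in the smaller set \<open>A - {u}\<close>.
\<close>

lemma dist_le_card_mult_chain:
  fixes U :: "'v \<Rightarrow> 'a::metric_space set"
  assumes "finite A" "u \<in> A" "\<And>x y. x \<in> A \<Longrightarrow> R x y \<Longrightarrow> y \<in> A"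
    and "\<And>x y. R x y \<Longrightarrow> U x \<inter> U y \<noteq> {}"
    and diam: "\<And>v x y. v \<in> A \<Longrightarrow> x \<in> U v \<Longrightarrow> y \<in> U v \<Longrightarrow> dist x y \<le> d"
    and "R\<^sup>*\<^sup>* u w" "x \<in> U u" "y \<in> U w"
  shows "dist x y \<le> real (card A) * d"
  using assms
proof (induction "card A" arbitrary: A u R x)
  case 0
  then show ?case by auto
next
  case (Suc n)
  have "0 \<le> d"
    using Suc.prems(5)[OF Suc.prems(2,7,7)] by simp
  show ?case
  proof (cases "u = w")
    case True
    then have "dist x y \<le> d"
      using Suc.prems(5)[of u x y] Suc.prems(2,7,8) by simp
    also have "d \<le> real (card A) * d"
      using \<open>0 \<le> d\<close> Suc.hyps(2)[symmetric] by (simp add: algebra_simps)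
    finally show ?thesis .
  next
    case False
    define R' where "R' = (\<lambda>x y. R x y \<and> x \<noteq> u \<and> y \<noteq> u)"
    obtain b where b: "R u b" "b \<noteq> u" "R'\<^sup>*\<^sup>* b w"
      using rtranclp_avoiding[OF Suc.prems(6) False] unfolding R'_def by auto
    obtain z where z: "z \<in> U u" "z \<in> U b"
      using Suc.prems(4)[OF b(1)] by auto
    have "b \<in> A" using Suc.prems(2,3) b(1) by blast
    have n: "n = card (A - {u})"
      using Suc.hyps(2) Suc.prems(1,2) by simp
    have "dist z y \<le> real (card (A - {u})) * d"
    proof (rule Suc.hyps(1)[OF n, of b R'])
      show "finite (A - {u})" "b \<in> A - {u}" "R'\<^sup>*\<^sup>* b w" "z \<in> U b" "y \<in> U w"
        using Suc.prems(1,8) \<open>b \<in> A\<close> b z by auto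
      show "\<And>x y. x \<in> A - {u} \<Longrightarrow> R' x y \<Longrightarrow> y \<in> A - {u}"
        using Suc.prems(3) unfolding R'_def by blast
      show "\<And>x y. R' x y \<Longrightarrow> U x \<inter> U y \<noteq> {}"
        using Suc.prems(4) unfolding R'_def by blast
      show "\<And>v x y. v \<in> A - {u} \<Longrightarrow> x \<in> U v \<Longrightarrow> y \<in> U v \<Longrightarrow> dist x y \<le> d"
        using Suc.prems(5) by blast
    qed
    moreover have "dist x z \<le> d"
      using Suc.prems(5)[OF Suc.prems(2,7) z(1)] .
    moreover have "dist x y \<le> dist x z + dist z y"
      by (rule dist_triangle)
    moreover have "real (card A) * d = d + real (card (A - {u})) * d"
      using n Suc.hyps(2)[symmetric] by (simp add: algebra_simps)
    ultimately show ?thesis by linarith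
  qed
qed

lemma connected_subset_one_class:
  fixes U :: "'v \<Rightarrow> 'a::topological_space set"
  assumes "finite W" "\<And>v. v \<in> W \<Longrightarrow> closed (U v)"
    and "connected C" "C \<subseteq> (\<Union>v\<in>W. U v)"
    and R: "\<And>v w. v \<in> W \<Longrightarrow> w \<in> W \<Longrightarrow> v \<noteq> w \<Longrightarrow> U v \<inter> U w \<noteq> {} \<Longrightarrow> R v w"
    and "u \<in> W" "w \<in> W" "x \<in> C" "y \<in> C" "x \<in> U u" "y \<in> U w"
  shows "R\<^sup>*\<^sup>* u w"
proof (rule ccontr)
  assume not: "\<not> R\<^sup>*\<^sup>* u w"
  define A where "A = {v \<in> W. R\<^sup>*\<^sup>* u v}"
  define P where "P = (\<Union>v\<in>A. U v)"
  define Q where "Q = (\<Union>v\<in>W - A. U v)"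
  have "closed P" "closed Q"
    unfolding P_def Q_def A_def using assms(1,2) by (auto intro!: closed_UN)
  moreover have "C \<subseteq> P \<union> Q"
    using assms(4) unfolding P_def Q_def by blast
  moreover have "P \<inter> Q = {}"
  proof -
    have False if "v \<in> A" "v' \<in> W - A" "z \<in> U v" "z \<in> U v'" for v v' z
    proof -
      have "R v v'" using R[of v v'] that unfolding A_def by auto
      then show False
        using that unfolding A_def by (auto dest: rtranclp.rtrancl_into_rtrancl)
    qed
    then show ?thesis unfolding P_def Q_def by blast
  qed
  moreover have "x \<in> P" "y \<in> Q"
    using assms not unfolding P_def Q_def A_def by auto
  ultimately show False
    using \<open>connected C\<close> assms(8,9) unfolding connected_closed by blast
qed

section \<open>Compositions along words\<close>

lemma word_map_same [simp]: "word_map f j j v = id"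
  by (simp add: word_map_def)

lemma foldr_comp_append: "foldr (\<circ>) (xs @ ys) id = foldr (\<circ>) xs id \<circ> foldr (\<circ>) ys id"
  by (induction xs) (auto simp: comp_assoc)

lemma word_map_Suc: "word_map f 0 (Suc k) v = word_map f 0 k v \<circ> f (Suc k) (v (Suc k))"
proof -
  have "[0 + 1..<Suc k + 1] = [0 + 1..<k + 1] @ [Suc k]" by simp
  then show ?thesis
    unfolding word_map_def by (simp only: map_append foldr_comp_append) simp
qed

lemma word_map_cong:
  assumes "\<And>l. l \<in> {1..k} \<Longrightarrow> v l = w l"
  shows "word_map f 0 k v = word_map f 0 k w"
  using assms by (induction k) (auto simp: word_map_Suc)

lemma word_map_add:
  "word_map f 0 (k + j) v =
     word_map f 0 k v \<circ> word_map (\<lambda>l. f (k + l)) 0 j (\<lambda>l. v (k + l))"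
  by (induction j) (auto simp: word_map_Suc comp_assoc)

lemma word_map_lipschitz:
  assumes "nonautonomous_ifs X I f c" "\<And>l. l \<in> {1..k} \<Longrightarrow> v l \<in> I l"
  shows "word_map f 0 k v ` X \<subseteq> X \<and> (c ^ k)-lipschitz_on X (word_map f 0 k v)"
  using assms(2)
proof (induction k)
  case 0
  then show ?case by (auto simp: lipschitz_on_def)
next
  case (Suc k)
  have IH: "word_map f 0 k v ` X \<subseteq> X" "(c ^ k)-lipschitz_on X (word_map f 0 k v)"
    using Suc by auto
  have "v (Suc k) \<in> I (Suc k)" using Suc.prems by simp
  then have f: "f (Suc k) (v (Suc k)) ` X \<subseteq> X" "c-lipschitz_on X (f (Suc k) (v (Suc k)))"
    using assms(1) unfolding nonautonomous_ifs_def by auto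
  have "(c ^ k * c)-lipschitz_on X (word_map f 0 k v \<circ> f (Suc k) (v (Suc k)))"
    using lipschitz_on_compose[OF f(2) lipschitz_on_subset[OF IH(2) f(1)]] .
  then show ?case
    using IH(1) f(1) by (auto simp: word_map_Suc mult.commute)
qed

section \<open>The coding map and the limit sets\<close>

lemma nonautonomous_ifs_shift:
  assumes "nonautonomous_ifs X I f c"
  shows "nonautonomous_ifs X (\<lambda>l. I (k + l)) (\<lambda>l. f (k + l)) c"
  using assms unfolding nonautonomous_ifs_def by simp

lemma nonautonomous_ifs_nonneg:
  assumes "nonautonomous_ifs X I f c"
  shows "0 \<le> c"
proof -
  obtain i where "i \<in> I 1"
    using assms unfolding nonautonomous_ifs_def by blast
  then have "c-lipschitz_on X (f 1 i)"
    using assms unfolding nonautonomous_ifs_def by simp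
  then show ?thesis by (rule lipschitz_on_nonneg)
qed

lemma dist_word_map_le:
  assumes "nonautonomous_ifs X I f c" "\<And>l. l \<in> {1..k} \<Longrightarrow> v l \<in> I l"
    and "x \<in> word_map f 0 k v ` X" "y \<in> word_map f 0 k v ` X"
  shows "dist x y \<le> c ^ k * diameter X"
proof -
  obtain a b where ab: "a \<in> X" "b \<in> X" "x = word_map f 0 k v a" "y = word_map f 0 k v b"
    using assms(3,4) by auto
  have "(c ^ k)-lipschitz_on X (word_map f 0 k v)"
    using word_map_lipschitz[OF assms(1,2)] by auto
  then have "dist x y \<le> c ^ k * dist a b"
    using ab by (auto dest: lipschitz_onD)
  also have "dist a b \<le> diameter X"
    using assms(1) ab unfolding nonautonomous_ifs_def
    by (intro diameter_bounded_bound compact_imp_bounded) auto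
  then have "c ^ k * dist a b \<le> c ^ k * diameter X"
    using nonautonomous_ifs_nonneg[OF assms(1)] by (intro mult_left_mono) auto
  finally show ?thesis .
qed

text \<open>The intersection that defines the coding map is indeed a singleton.\<close>

lemma coding_map_Inter:
  assumes ifs: "nonautonomous_ifs X I f c" and \<omega>: "\<And>l. l \<ge> 1 \<Longrightarrow> \<omega> l \<in> I l"
  shows "(\<Inter>j\<in>{1..}. word_map f 0 j \<omega> ` X) = {coding_map X f \<omega>}"
proof -
  let ?F = "\<lambda>j. word_map f 0 j \<omega> ` X"
  have X: "compact X" "X \<noteq> {}" "c < 1"
    using ifs unfolding nonautonomous_ifs_def by auto
  have lip: "word_map f 0 j \<omega> ` X \<subseteq> X \<and> (c ^ j)-lipschitz_on X (word_map f 0 j \<omega>)" for j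
    by (rule word_map_lipschitz[OF ifs]) (use \<omega> in auto)
  have "compact (?F j)" for j
    using lip[of j] X by (intro compact_continuous_image lipschitz_on_continuous_on) auto
  then have cl: "closed (?F j)" for j
    by (rule compact_imp_closed)
  have mono: "?F n \<subseteq> ?F m" if "m \<le> n" for m n
  proof -
    have "word_map (\<lambda>l. f (m + l)) 0 (n - m) (\<lambda>l. \<omega> (m + l)) ` X \<subseteq> X"
      using word_map_lipschitz[OF nonautonomous_ifs_shift[OF ifs, of m]] \<omega> by simp
    then show ?thesis
      using word_map_add[of f m "n - m" \<omega>] that by (auto simp: image_comp[symmetric])
  qed
  have "X \<inter> (\<Inter>j. ?F j) \<noteq> {}"
  proof (rule compact_imp_fip_image[OF X(1) cl])
    fix S :: "nat set" assume "finite S"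
    then have "j \<le> Max (insert 0 S)" if "j \<in> S" for j using that by simp
    then have "?F (Max (insert 0 S)) \<subseteq> X \<inter> (\<Inter>j\<in>S. ?F j)"
      using lip[of "Max (insert 0 S)"] by (intro Int_greatest INT_greatest mono) blast+
    then show "X \<inter> (\<Inter>j\<in>S. ?F j) \<noteq> {}" using X(2) by blast
  qed
  then obtain x where x: "x \<in> (\<Inter>j. ?F j)" by blast
  have "y = x" if "y \<in> (\<Inter>j\<in>{1..}. ?F j)" for y
  proof -
    have "dist x y \<le> c ^ j * diameter X" if "j \<ge> 1" for j
      by (rule dist_word_map_le[OF ifs]) (use \<omega> x \<open>y \<in> _\<close> that in auto)
    moreover have "(\<lambda>j. c ^ j * diameter X) \<longlonglongrightarrow> 0 * diameter X"
      using X(3) nonautonomous_ifs_nonneg[OF ifs] by (intro tendsto_intros LIMSEQ_power_zero) auto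
    ultimately have "dist x y \<le> 0"
      by (intro tendsto_lowerbound[of "\<lambda>j. c ^ j * diameter X" _ sequentially])
         (auto simp: eventually_sequentially)
    then show ?thesis by simp
  qed
  with x have "(\<Inter>j\<in>{1..}. ?F j) = {x}" by auto
  then show ?thesis unfolding coding_map_def by simp
qed

lemma coding_map_mem:
  assumes "nonautonomous_ifs X I f c" "\<And>l. l \<ge> 1 \<Longrightarrow> \<omega> l \<in> I l"
  shows "coding_map X f \<omega> \<in> X"
proof -
  have "coding_map X f \<omega> \<in> word_map f 0 1 \<omega> ` X"
    using coding_map_Inter[OF assms] by auto
  then show ?thesis
    using word_map_lipschitz[OF assms(1), of 1 \<omega>] assms(2) by auto
qed

lemma coding_map_eqI:
  assumes "nonautonomous_ifs X I f c" "\<And>l. l \<ge> 1 \<Longrightarrow> \<omega> l \<in> I l"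
    and "\<And>j. j \<ge> n \<Longrightarrow> x \<in> word_map f 0 j \<omega> ` X"
  shows "coding_map X f \<omega> = x"
proof -
  have "x \<in> word_map f 0 j \<omega> ` X" for j
  proof -
    have "word_map (\<lambda>l. f (j + l)) 0 n (\<lambda>l. \<omega> (j + l)) ` X \<subseteq> X"
      using word_map_lipschitz[OF nonautonomous_ifs_shift[OF assms(1), of j]] assms(2) by simp
    then show ?thesis
      using word_map_add[of f j n \<omega>] assms(3)[of "j + n"] by (auto simp: image_comp[symmetric])
  qed
  then have "x \<in> (\<Inter>j\<in>{1..}. word_map f 0 j \<omega> ` X)" by blast
  then have "x \<in> {coding_map X f \<omega>}" by (simp only: coding_map_Inter[OF assms(1,2)])
  then show ?thesis by simp
qed

lemma coding_map_shift:
  assumes "nonautonomous_ifs X I f c" "\<And>l. l \<ge> 1 \<Longrightarrow> \<omega> l \<in> I l"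
  shows "coding_map X f \<omega> =
           word_map f 0 k \<omega> (coding_map X (\<lambda>l. f (k + l)) (\<lambda>l. \<omega> (k + l)))"
proof (rule coding_map_eqI[OF assms, where n = "Suc k"])
  fix j assume j: "j \<ge> Suc k"
  have "coding_map X (\<lambda>l. f (k + l)) (\<lambda>l. \<omega> (k + l)) \<in>
          (\<Inter>j\<in>{1..}. word_map (\<lambda>l. f (k + l)) 0 j (\<lambda>l. \<omega> (k + l)) ` X)"
    by (subst coding_map_Inter[OF nonautonomous_ifs_shift[OF assms(1)]]) (use assms(2) in auto)
  then have "coding_map X (\<lambda>l. f (k + l)) (\<lambda>l. \<omega> (k + l)) \<in>
          word_map (\<lambda>l. f (k + l)) 0 (j - k) (\<lambda>l. \<omega> (k + l)) ` X"
    using j by auto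
  then show "word_map f 0 k \<omega> (coding_map X (\<lambda>l. f (k + l)) (\<lambda>l. \<omega> (k + l)))
               \<in> word_map f 0 j \<omega> ` X"
    using word_map_add[of f k "j - k" \<omega>] j by auto
qed

lemma coding_map_cong:
  assumes "\<And>l. l \<ge> 1 \<Longrightarrow> v l = w l"
  shows "coding_map X f v = coding_map X f w"
proof -
  have "word_map f 0 j v = word_map f 0 j w" for j
    by (rule word_map_cong) (use assms in auto)
  then show ?thesis unfolding coding_map_def by simp
qed

text \<open>The value at \<open>0\<close> of the coding word is irrelevant.\<close>

lemma limit_setI:
  assumes "\<And>l. l \<ge> 1 \<Longrightarrow> \<omega> l \<in> I l"
  shows "coding_map X f \<omega> \<in> limit_set X I f"
  unfolding limit_set_def
proof (rule image_eqI)
  show "restrict \<omega> {1..} \<in> PiE {1..} I" using assms by auto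
  show "coding_map X f \<omega> = coding_map X f (restrict \<omega> {1..})"
    by (rule coding_map_cong) auto
qed

lemma limit_set_subset:
  assumes "nonautonomous_ifs X I f c"
  shows "limit_set X I f \<subseteq> X"
  unfolding limit_set_def using coding_map_mem[OF assms] by (auto simp: PiE_iff)

lemma limit_set_decomposition:
  assumes "nonautonomous_ifs X I f c"
  shows "limit_set X I f =
           (\<Union>v\<in>PiE {1..k} I. word_map f 0 k v ` shifted_limit_set X I f k)"
proof (intro equalityI subsetI)
  fix x assume "x \<in> limit_set X I f"
  then obtain \<omega> where \<omega>: "\<omega> \<in> PiE {1..} I" "x = coding_map X f \<omega>"
    unfolding limit_set_def by auto
  have I: "\<omega> l \<in> I l" if "l \<ge> 1" for l using \<omega>(1) that by auto
  have "x = word_map f 0 k \<omega> (coding_map X (\<lambda>l. f (k + l)) (\<lambda>l. \<omega> (k + l)))"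
    unfolding \<omega>(2) by (rule coding_map_shift[OF assms I])
  moreover have "word_map f 0 k \<omega> = word_map f 0 k (restrict \<omega> {1..k})"
    by (rule word_map_cong) auto
  moreover have "coding_map X (\<lambda>l. f (k + l)) (\<lambda>l. \<omega> (k + l)) \<in> shifted_limit_set X I f k"
    unfolding shifted_limit_set_def by (rule limit_setI) (use I in auto)
  moreover have "restrict \<omega> {1..k} \<in> PiE {1..k} I" using I by auto
  ultimately show "x \<in> (\<Union>v\<in>PiE {1..k} I. word_map f 0 k v ` shifted_limit_set X I f k)"
    by (metis UN_I imageI)
next
  fix x assume "x \<in> (\<Union>v\<in>PiE {1..k} I. word_map f 0 k v ` shifted_limit_set X I f k)"
  then obtain v \<tau> where v: "v \<in> PiE {1..k} I" and \<tau>: "\<tau> \<in> PiE {1..} (\<lambda>l. I (k + l))"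
    and x: "x = word_map f 0 k v (coding_map X (\<lambda>l. f (k + l)) \<tau>)"
    unfolding shifted_limit_set_def limit_set_def by auto
  define \<omega> where "\<omega> = (\<lambda>l. if l \<le> k then v l else \<tau> (l - k))"
  have I: "\<omega> l \<in> I l" if "l \<ge> 1" for l
    using v PiE_mem[OF \<tau>, of "l - k"] that unfolding \<omega>_def by auto
  have "word_map f 0 k v = word_map f 0 k \<omega>"
    by (rule word_map_cong) (auto simp: \<omega>_def)
  moreover have "coding_map X (\<lambda>l. f (k + l)) \<tau> = coding_map X (\<lambda>l. f (k + l)) (\<lambda>l. \<omega> (k + l))"
    by (rule coding_map_cong) (auto simp: \<omega>_def)
  ultimately have "x = coding_map X f \<omega>"
    unfolding x using coding_map_shift[OF assms I] by simp
  then show "x \<in> limit_set X I f" using limit_setI[of \<omega> I X f] I by simp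
qed

section \<open>Compactness of the limit sets\<close>

text \<open>
  Since \<open>I 1\<close> is finite and each \<open>f 1 i\<close> maps compact subsets of \<open>X\<close> to compact sets, the
  right-hand side is
  closed.
\<close>

lemma closure_limit_set_subset:
  assumes ifs: "nonautonomous_ifs X I f c"
  shows "closure (limit_set X I f) \<subseteq>
           (\<Union>i\<in>I 1. f 1 i ` closure (limit_set X (\<lambda>l. I (Suc l)) (\<lambda>l. f (Suc l))))"
    (is "_ \<subseteq> (\<Union>i\<in>I 1. f 1 i ` closure ?L)")
proof -
  have X: "compact X" using ifs unfolding nonautonomous_ifs_def by auto
  have "?L \<subseteq> X"
    using limit_set_subset[OF nonautonomous_ifs_shift[OF ifs, of 1]] by simp
  then have sub: "closure ?L \<subseteq> X"
    using X by (intro closure_minimal compact_imp_closed) auto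
  then have cpt: "compact (closure ?L)"
    using X by (metis closed_closure compact_Int_closed inf.absorb_iff2)
  have "limit_set X I f \<subseteq> (\<Union>i\<in>I 1. f 1 i ` ?L)"
    using limit_set_decomposition[OF ifs, of 1]
    by (auto simp: shifted_limit_set_def word_map_def PiE_iff)
  also have "\<dots> \<subseteq> (\<Union>i\<in>I 1. f 1 i ` closure ?L)"
    using closure_subset by blast
  finally have "limit_set X I f \<subseteq> (\<Union>i\<in>I 1. f 1 i ` closure ?L)" .
  moreover have "compact (f 1 i ` closure ?L)" if "i \<in> I 1" for i
  proof -
    have "c-lipschitz_on X (f 1 i)"
      using ifs that unfolding nonautonomous_ifs_def by auto
    then have "continuous_on (closure ?L) (f 1 i)"
      using sub by (blast intro: lipschitz_on_continuous_on continuous_on_subset)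
    then show ?thesis using cpt by (rule compact_continuous_image)
  qed
  then have "closed (\<Union>i\<in>I 1. f 1 i ` closure ?L)"
    using ifs unfolding nonautonomous_ifs_def by (intro closed_UN ballI compact_imp_closed) auto
  ultimately show ?thesis by (rule closure_minimal)
qed

lemma compact_limit_set:
  assumes ifs: "nonautonomous_ifs X I f c"
  shows "compact (limit_set X I f)"
proof -
  define K where "K = (\<lambda>n. closure (limit_set X (\<lambda>l. I (n + l)) (\<lambda>l. f (n + l))))"
  have X: "compact X" using ifs unfolding nonautonomous_ifs_def by auto
  have KX: "K n \<subseteq> X" for n
    unfolding K_def using X limit_set_subset[OF nonautonomous_ifs_shift[OF ifs, of n]]
    by (intro closure_minimal compact_imp_closed) auto
  have step: "\<exists>z\<in>K (Suc n). \<exists>i\<in>I (Suc n). y = f (Suc n) i z" if "y \<in> K n" for n y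
  proof -
    have "y \<in> (\<Union>i\<in>I (n + 1). f (n + 1) i `
        closure (limit_set X (\<lambda>l. I (n + Suc l)) (\<lambda>l. f (n + Suc l))))"
      using closure_limit_set_subset[OF nonautonomous_ifs_shift[OF ifs, of n]]
        that[unfolded K_def] by (rule subsetD)
    then show ?thesis by (auto simp: K_def)
  qed
  have "closure (limit_set X I f) \<subseteq> limit_set X I f"
  proof
    fix x assume x: "x \<in> closure (limit_set X I f)"
    \<comment> \<open>trace \<open>x\<close> backwards through the levels, staying in the closures\<close>
    have "\<exists>y. \<forall>n. (y n \<in> K n \<and> (n = 0 \<longrightarrow> y n = x)) \<and>
        (\<exists>i\<in>I (Suc n). y n = f (Suc n) i (y (Suc n)))"
    proof (rule dependent_nat_choice)
      show "\<exists>y. y \<in> K 0 \<and> (0 = 0 \<longrightarrow> y = x)" using x by (simp add: K_def)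
    qed (use step in blast)
    then obtain y where y: "\<And>n. y n \<in> K n" "y 0 = x"
        "\<And>n. \<exists>i\<in>I (Suc n). y n = f (Suc n) i (y (Suc n))"
      by blast
    from y(3) have "\<forall>n. \<exists>i. i \<in> I (Suc n) \<and> y n = f (Suc n) i (y (Suc n))" by blast
    from choice[OF this] obtain g
      where g: "\<And>n. g n \<in> I (Suc n)" "\<And>n. y n = f (Suc n) (g n) (y (Suc n))"
      by blast
    define \<omega> where "\<omega> = (\<lambda>l. g (l - 1))"
    have I: "\<omega> l \<in> I l" if "l \<ge> 1" for l
      using g(1)[of "l - 1"] that by (simp add: \<omega>_def)
    have "x = word_map f 0 n \<omega> (y n)" for n
    proof (induction n)
      case (Suc n)
      with g(2)[of n] show ?case by (simp add: word_map_Suc \<omega>_def)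
    qed (simp add: y(2))
    then have "x \<in> word_map f 0 n \<omega> ` X" for n
      using y(1) KX by blast
    then have "coding_map X f \<omega> = x"
      by (intro coding_map_eqI[OF ifs I])
    then show "x \<in> limit_set X I f" using limit_setI[of \<omega> I X f] I by simp
  qed
  then have "closure (limit_set X I f) = limit_set X I f"
    using closure_subset by blast
  then have "closed (limit_set X I f)" by (metis closed_closure)
  moreover have "limit_set X I f = X \<inter> limit_set X I f"
    using limit_set_subset[OF ifs] by blast
  ultimately show ?thesis using X by (metis compact_Int_closed)
qed

section \<open>Components of the nerve\<close>

lemma vertex_equiv_eq_rtranclp:
  "vertex_equiv K = (\<lambda>u v. u \<noteq> v \<and> {u, v} \<in> K)\<^sup>*\<^sup>*"
proof -
  have "symp (\<lambda>u v. u \<noteq> v \<and> {u, v} \<in> K)"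
    by (auto intro!: sympI simp: insert_commute)
  then show ?thesis
    unfolding vertex_equiv_def equivclp_def by (simp add: symp_symclp_eq)
qed

text \<open>
  The hypothesis on \<open>K\<close> is the part of closure under subsets that guarantees that all vertices of a
  class survive in the corresponding component.
\<close>

lemma card_class_le_Max_component:
  assumes fin: "finite (vertices K)" and sing: "\<And>v. v \<in> vertices K \<Longrightarrow> {v} \<in> K"
    and u: "u \<in> vertices K"
  shows "finite {v. vertex_equiv K u v}"
    and "card {v. vertex_equiv K u v} \<le> Max {card (vertices L) | L. L \<in> complex_components K}"
proof -
  let ?A = "{v. vertex_equiv K u v}"
  have A: "?A \<subseteq> vertices K"
  proof
    fix v assume "v \<in> ?A"
    then have "(\<lambda>u v. u \<noteq> v \<and> {u, v} \<in> K)\<^sup>*\<^sup>* u v"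
      by (simp add: vertex_equiv_eq_rtranclp)
    then show "v \<in> vertices K"
      by (induction rule: rtranclp_induct) (use u in \<open>auto simp: vertices_def\<close>)
  qed
  with fin show "finite ?A" by (rule finite_subset[rotated])
  have "vertices {s \<in> K. s \<subseteq> ?A} = ?A"
    using A sing unfolding vertices_def by blast
  then have "card ?A \<in> {card (vertices L) | L. L \<in> complex_components K}"
    unfolding complex_components_def using u
    by (intro CollectI exI[of _ "{s \<in> K. s \<subseteq> ?A}"]) auto
  moreover have "finite (complex_components K)"
    unfolding complex_components_def using fin by (simp add: setcompr_eq_image)
  then have "finite {card (vertices L) | L. L \<in> complex_components K}"
    by (simp add: setcompr_eq_image)
  ultimately show "card ?A \<le> Max {card (vertices L) | L. L \<in> complex_components K}"
    by simp
qed

text \<open>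
  The set \<open>C\<close> is covered by the closed pieces \<open>U v\<close>; being connected, it meets only pieces from one
  class of words, and these chain together to the stated bound.
\<close>

lemma dist_le_Max_component:
  assumes ifs: "nonautonomous_ifs X I f c"
    and C: "connected C" "C \<subseteq> limit_set X I f" and xy: "x \<in> C" "y \<in> C"
  shows "dist x y \<le> c ^ k *
    real (Max {card (vertices K) | K. K \<in> complex_components (nerve X I f 0 k)}) * diameter X"
proof -
  let ?N = "nerve X I f 0 k"
  let ?R = "\<lambda>u v. u \<noteq> v \<and> {u, v} \<in> ?N"
  define W where "W = PiE {1..k} I"
  define U where "U = (\<lambda>v. word_map f 0 k v ` shifted_limit_set X I f k)"
  have ifs_k: "nonautonomous_ifs X (\<lambda>l. I (k + l)) (\<lambda>l. f (k + l)) c"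
    using ifs by (rule nonautonomous_ifs_shift)
  have finW: "finite W"
    unfolding W_def using ifs by (intro finite_PiE) (auto simp: nonautonomous_ifs_def)
  have JX: "shifted_limit_set X I f k \<subseteq> X"
    unfolding shifted_limit_set_def by (rule limit_set_subset[OF ifs_k])
  have WI: "v l \<in> I l" if "v \<in> W" "l \<in> {1..k}" for v l
    using that unfolding W_def by auto
  have pair: "{u, v} \<in> ?N \<longleftrightarrow> u \<in> W \<and> v \<in> W \<and> U u \<inter> U v \<noteq> {}" for u v
    unfolding nerve_def W_def U_def by auto
  have vert: "v \<in> W" if "v \<in> vertices ?N" for v
    using that unfolding vertices_def nerve_def W_def by auto
  have sing: "{v} \<in> ?N" if "v \<in> vertices ?N" for v
    using that unfolding vertices_def nerve_def by auto
  have closedU: "closed (U v)" if "v \<in> W" for v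
  proof -
    have "continuous_on X (word_map f 0 k v)"
      using word_map_lipschitz[OF ifs WI[OF that]] lipschitz_on_continuous_on by blast
    then have "compact (U v)"
      unfolding U_def using JX compact_limit_set[OF ifs_k]
      by (intro compact_continuous_image)
         (auto simp: shifted_limit_set_def intro: continuous_on_subset)
    then show ?thesis by (rule compact_imp_closed)
  qed
  have cover: "C \<subseteq> (\<Union>v\<in>W. U v)"
    using C(2) limit_set_decomposition[OF ifs, of k] unfolding W_def U_def by simp
  obtain u w where u: "u \<in> W" "x \<in> U u" and w: "w \<in> W" "y \<in> U w"
    using cover xy by blast
  have edge: "?R v v'" if "v \<in> W" "v' \<in> W" "v \<noteq> v'" "U v \<inter> U v' \<noteq> {}" for v v'
    using pair that by blast
  have path: "?R\<^sup>*\<^sup>* u w"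
    by (rule connected_subset_one_class[where U = U, OF finW closedU C(1) cover edge])
       (use u w xy in auto)
  define A where "A = {v. vertex_equiv ?N u v}"
  have "{u, u} \<in> ?N" using pair u by blast
  then have uV: "u \<in> vertices ?N" unfolding vertices_def by auto
  have finV: "finite (vertices ?N)"
    using finW vert by (meson finite_subset subsetI)
  note card_A = card_class_le_Max_component[OF finV sing uV]
  have AW: "v \<in> W" if "v \<in> A" for v
  proof -
    have "?R\<^sup>*\<^sup>* u v" using that unfolding A_def by (simp add: vertex_equiv_eq_rtranclp)
    then show ?thesis by (induction rule: rtranclp_induct) (use u pair in auto)
  qed
  have "dist x y \<le> real (card A) * (c ^ k * diameter X)"
  proof (rule dist_le_card_mult_chain[where R = ?R and U = U])
    show "finite A" using card_A(1) by (simp add: A_def)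
    show "u \<in> A" by (simp add: A_def vertex_equiv_eq_rtranclp)
    show "\<And>x y. x \<in> A \<Longrightarrow> ?R x y \<Longrightarrow> y \<in> A"
      unfolding A_def vertex_equiv_eq_rtranclp by (auto intro: rtranclp.rtrancl_into_rtrancl)
    show "\<And>x y. ?R x y \<Longrightarrow> U x \<inter> U y \<noteq> {}" using pair by blast
    show "dist a b \<le> c ^ k * diameter X" if "v \<in> A" "a \<in> U v" "b \<in> U v" for v a b
      using that JX unfolding U_def
      by (intro dist_word_map_le[OF ifs WI[OF AW[OF that(1)]]]) auto
  qed (use path u w in auto)
  also have "\<dots> \<le> real (Max {card (vertices K) | K. K \<in> complex_components ?N}) *
      (c ^ k * diameter X)"
  proof (rule mult_right_mono)
    show "0 \<le> c ^ k * diameter X"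
      using nonautonomous_ifs_nonneg[OF ifs] ifs unfolding nonautonomous_ifs_def
      by (intro mult_nonneg_nonneg diameter_ge_0 compact_imp_bounded) auto
  qed (use card_A(2) in \<open>simp add: A_def\<close>)
  finally show ?thesis by (simp add: mult_ac)
qed

section \<open>Total disconnectedness\<close>

theorem theorem3:
  fixes X :: "'a::metric_space set"
    and I :: "nat \<Rightarrow> 'i set"
    and f :: "nat \<Rightarrow> 'i \<Rightarrow> 'a \<Rightarrow> 'a"
    and c :: real
  assumes "nonautonomous_ifs X I f c"
    and "(\<lambda>k. c ^ k * real (Max {card (vertices K) | K. K \<in> complex_components (nerve X I f 0 k)}))
           \<longlonglongrightarrow> 0"
  shows "totally_disconnected (limit_set X I f)"
  unfolding totally_disconnected_def
proof
  fix C assume C: "C \<in> components (limit_set X I f)"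
  have conn: "connected C" "C \<subseteq> limit_set X I f" "C \<noteq> {}"
    using C by (auto simp: in_components_connected in_components_subset in_components_nonempty)
  have "x = y" if "x \<in> C" "y \<in> C" for x y
  proof -
    have "(\<lambda>k. c ^ k *
        real (Max {card (vertices K) | K. K \<in> complex_components (nerve X I f 0 k)}) * diameter X)
        \<longlonglongrightarrow> 0 * diameter X"
      by (intro tendsto_mult assms(2) tendsto_const)
    then have "dist x y \<le> 0 * diameter X"
      by (rule tendsto_lowerbound)
         (use dist_le_Max_component[OF assms(1) conn(1,2) that] in auto)
    then show ?thesis by simp
  qed
  with conn(3) show "\<exists>x. C = {x}" by blast
qed

end
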